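(* Let $\mathbb{F}$ be a field, $m>n$ positive integers, $A=J_m\oplus J_n$, and let $(A,B)$ be an indecomposable pair of commuting nilpotent $(m+n)\times(m+n)$ matrices over $\mathbb{F}$. Assume that $B$ has canonical rank $r$, so that $1\le r\le n$ and $B=T_{m,n}(a;b;c;d)$ with $a_0=d_0=0$, $b_i=c_i=0$ for $0\le i<n-r$, $d_i=a_i$ for $1\le i\le n-r$, and $(b_{n-r},c_{n-r})\ne(0,0)$. (1) If $c_{n-r}\neq 0$, let $X=T_{m,n}(x;y;z;w)$ with $x_0=1$, $x_i=0$ for $1\le i\le m-1$; $y_i=a_{m-r+i}$ for $0\le i\le r-1$ and $y_i=0$ for $r\le i\le n-1$; $z_i=0$ for all $i$; $w_i=c_{n-r+i}$ for $0\le i\le r-1$ and $w_i=0$ for $r\le i\le n-1$. Then $(J_m\oplus J_n,\,X^{-1}BX)$ is the canonical form for $(A,B)$. (2) If $c_{n-r}=0$ and $b_{n-r}\ne0$, let $X=T_{m,n}(x;y;z;w)$ with $x_0=1$, $x_i=0$ for $1\le i\le m-1$; $y_i=0$ for all $i$; $z_i=a_{m-r+i}$ for $0\le i\le r-1$ and $z_i=0$ for $r\le i\le n-1$; $w_i=b_{n-r+i}$ for $0\le i\le r-1$ and $w_i=0$ for $r\le i\le n-1$. Then $(J_m\oplus J_n,\,XBX^{-1})$ is the canonical form for $(A,B)$.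
   Context: Two pairs $(A,B)$, $(C,D)$ of $N\times N$ matrices over $\mathbb{F}$ are similar if there is a non-singular $X$ over $\mathbb{F}$ with $X^{-1}AX=C$ and $X^{-1}BX=D$. A pair $(A,B)$ is a commuting nilpotent pair if $AB=BA$ and $A$, $B$ are nilpotent. A pair is decomposable if it is similar to a pair $(A_1\oplus A_2,B_1\oplus B_2)$ (block diagonal) where $A_1,B_1$ are square of the same size, $A_2,B_2$ are square of the same size, and both sizes are at least $1$; otherwise it is indecomposable. $J_k$ is the $k\times k$ nilpotent Jordan block with $1$'s on the superdiagonal and $0$ elsewhere. For $m>n\ge1$, $s=m-n$, and scalars $a=(a_0,\dots,a_{m-1})$, $b=(b_0,\dots,b_{n-1})$, $c=(c_0,\dots,c_{n-1})$, $d=(d_0,\dots,d_{n-1})$ in $\mathbb{F}$, let $T_{m,n}(a;b;c;d)$ be the $(m+n)\times(m+n)$ block matrix $\begin{bmatrix}P&Q\\R&S\end{bmatrix}$ with $P$ of size $m\times m$, $P_{ij}=a_{j-i}$; $Q$ of size $m\times n$, $Q_{ij}=b_{j-i}$; $R$ of size $n\times m$, $R_{ij}=c_{j-i-s}$; $S$ of size $n\times n$, $S_{ij}=d_{j-i}$; where entries with a negative subscript are $0$. By a theorem of Turnbull and Aitken, the matrices commuting with $J_m\oplus J_n$ are exactly the matrices $T_{m,n}(a;b;c;d)$ (with uniquely determined parameters), and if such a matrix is nilpotent then $a_0=d_0=0$. Canonical rank: if $A=J_m\oplus J_n$, $B=T_{m,n}(a;b;c;d)$ is nilpotent and $(A,B)$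 is indecomposable, then there is a unique $r$ with $1\le r\le n$ such that $(b_{n-r},c_{n-r})\neq(0,0)$, $(b_i,c_i)=(0,0)$ for $0\le i<n-r$, and moreover $d_i=a_i$ for $1\le i\le n-r$; this $r$ is the canonical rank of $B$. Canonical form: a pair $(J_m\oplus J_n,T_{m,n}(a;b;c;d))$ is in canonical form if for some $1\le r\le n$ one has $a_0=0$, $a_i=0$ for $m-r\le i\le m-1$, $d_i=a_i$ for $0\le i\le n-r$, and either (type $B_{m,n,r}$) $b_i=0$ for $0\le i<n-r$, $c_{n-r}=1$ and $c_i=0$ for $i\ne n-r$; or (type $B'_{m,n,r}$) $b_{n-r}=1$, $b_i=0$ for $i\neq n-r$, and $c_i=0$ for $0\le i\le n-r$; all other parameters are arbitrary. "The canonical form for $(A,B)$" means the (unique) pair in canonical form that is similar to $(A,B)$. *)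

theory Defs
  imports
    "Jordan_Normal_Form.Jordan_Normal_Form"
    "Jordan_Normal_Form.Gauss_Jordan_Elimination"
begin

text \<open>Pairs of matrices are written as two separate arguments.\<close>

definition similar_pairs :: "'a::field mat \<Rightarrow> 'a mat \<Rightarrow> 'a mat \<Rightarrow> 'a mat \<Rightarrow> bool" where
  "similar_pairs A B C D \<longleftrightarrow>
     (\<exists>X X'. similar_mat_wit C A X' X \<and> similar_mat_wit D B X' X)"
    \<comment> \<open>the witness \<open>X'\<close> is the inverse of \<open>X\<close>: this says \<open>C = X' A X\<close> and \<open>D = X' B X\<close>\<close>

definition nilpotent_mat :: "'a::field mat \<Rightarrow> bool" where
  "nilpotent_mat A \<longleftrightarrow>
     square_mat A \<and> (\<exists>k. A ^\<^sub>m k = 0\<^sub>m (dim_row A) (dim_row A))"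

definition commuting_nilpotent_pair :: "nat \<Rightarrow> 'a::field mat \<Rightarrow> 'a mat \<Rightarrow> bool" where
  "commuting_nilpotent_pair N A B \<longleftrightarrow>
     A \<in> carrier_mat N N \<and> B \<in> carrier_mat N N \<and> A * B = B * A \<and>
     nilpotent_mat A \<and> nilpotent_mat B"

definition decomposable_pair :: "'a::field mat \<Rightarrow> 'a mat \<Rightarrow> bool" where
  "decomposable_pair A B \<longleftrightarrow>
     (\<exists>k l A1 B1 A2 B2. 1 \<le> k \<and> 1 \<le> l \<and>
        A1 \<in> carrier_mat k k \<and> B1 \<in> carrier_mat k k \<and>
        A2 \<in> carrier_mat l l \<and> B2 \<in> carrier_mat l l \<and>
        similar_pairs A B (diag_block_mat [A1, A2]) (diag_block_mat [B1, B2]))"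

abbreviation indecomposable_pair :: "'a::field mat \<Rightarrow> 'a mat \<Rightarrow> bool" where
  "indecomposable_pair A B \<equiv> \<not> decomposable_pair A B"

abbreviation JJ :: "nat \<Rightarrow> nat \<Rightarrow> 'a::field mat" where
  "JJ m n \<equiv> diag_block_mat [jordan_block m 0, jordan_block n 0]"

text \<open>
  The matrices \<open>T\<^bsub>m,n\<^esub>(a;b;c;d)\<close>, for \<open>n < m\<close>. The parameter lists are functions on the
  naturals, of which only the values \<open>a i\<close> with \<open>i < m\<close> and \<open>b i\<close>, \<open>c i\<close>, \<open>d i\<close> with
  \<open>i < n\<close> occur in the matrix.
  The guards replace the convention that entries with a negative subscript are zero.
\<close>

definition T_mat ::
  "nat \<Rightarrow> nat \<Rightarrow> (nat \<Rightarrow> 'a::field) \<Rightarrow> (nat \<Rightarrow> 'a) \<Rightarrow> (nat \<Rightarrow> 'a) \<Rightarrow> (nat \<Rightarrow> 'a) \<Rightarrow> 'a mat" where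
  "T_mat m n a b c d =
     (let s = m - n in
      four_block_mat
        (mat m m (\<lambda>(i, j). if i \<le> j then a (j - i) else 0))
        (mat m n (\<lambda>(i, j). if i \<le> j then b (j - i) else 0))
        (mat n m (\<lambda>(i, j). if i + s \<le> j then c (j - i - s) else 0))
        (mat n n (\<lambda>(i, j). if i \<le> j then d (j - i) else 0)))"

definition canonical_rank :: "nat \<Rightarrow> nat \<Rightarrow> 'a::field mat \<Rightarrow> nat \<Rightarrow> bool" where
  "canonical_rank m n B r \<longleftrightarrow> 1 \<le> r \<and> r \<le> n \<and>
     (\<exists>a b c d. B = T_mat m n a b c d \<and>
        (b (n - r), c (n - r)) \<noteq> (0, 0) \<and>
        (\<forall>i < n - r. (b i, c i) = (0, 0)) \<and>
        (\<forall>i. 1 \<le> i \<and> i \<le> n - r \<longrightarrow> d i = a i))"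

definition type_B :: "nat \<Rightarrow> nat \<Rightarrow> (nat \<Rightarrow> 'a::field) \<Rightarrow> (nat \<Rightarrow> 'a) \<Rightarrow> bool" where
  "type_B n r b c \<longleftrightarrow>
     (\<forall>i < n - r. b i = 0) \<and> c (n - r) = 1 \<and> (\<forall>i < n. i \<noteq> n - r \<longrightarrow> c i = 0)"

definition type_B' :: "nat \<Rightarrow> nat \<Rightarrow> (nat \<Rightarrow> 'a::field) \<Rightarrow> (nat \<Rightarrow> 'a) \<Rightarrow> bool" where
  "type_B' n r b c \<longleftrightarrow>
     b (n - r) = 1 \<and> (\<forall>i < n. i \<noteq> n - r \<longrightarrow> b i = 0) \<and> (\<forall>i \<le> n - r. c i = 0)"

definition in_canonical_form :: "'a::field mat \<Rightarrow> 'a mat \<Rightarrow> bool" where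
  "in_canonical_form A B \<longleftrightarrow>
     (\<exists>m n r a b c d. 1 \<le> n \<and> n < m \<and> 1 \<le> r \<and> r \<le> n \<and>
        A = JJ m n \<and> B = T_mat m n a b c d \<and>
        a 0 = 0 \<and> (\<forall>i. m - r \<le> i \<and> i \<le> m - 1 \<longrightarrow> a i = 0) \<and>
        (\<forall>i \<le> n - r. d i = a i) \<and>
        (type_B n r b c \<or> type_B' n r b c))"

text \<open>The pair \<open>(C, D)\<close> is \<^emph>\<open>the\<close> canonical form for \<open>(A, B)\<close>, uniqueness included.\<close>

definition is_the_canonical_form_for ::
  "'a::field mat \<Rightarrow> 'a mat \<Rightarrow> 'a mat \<Rightarrow> 'a mat \<Rightarrow> bool" where
  "is_the_canonical_form_for A B C D \<longleftrightarrow>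
     in_canonical_form C D \<and> similar_pairs A B C D \<and>
     (\<forall>C' D'. in_canonical_form C' D' \<and> similar_pairs A B C' D' \<longrightarrow> C' = C \<and> D' = D)"

end

theory Submission
  imports Defs "HOL-Computational_Algebra.Formal_Power_Series"
begin

text \<open>
  The matrix \<open>T\<^bsub>m,n\<^esub>(a;b;c;d)\<close> is the image of the matrix \<open>[a(t), b(t); t\<^sup>s c(t), d(t)]\<close> of power series,
  \<open>s = m - n\<close>, with the upper left entry taken modulo \<open>t\<^sup>m\<close> and the parameters \<open>b\<close>, \<open>c\<close>, \<open>d\<close> modulo
  \<open>t\<^sup>n\<close>; products of matrices \<open>T\<close> are products of these two-by-two matrices (\<open>T_ser_mult\<close>). Everything
  then becomes a computation with congruences between power series.

  Existence. Put \<open>p = n - r\<close>. If \<open>c\<^sub>p \<noteq> 0\<close>, then \<open>c \<equiv> t\<^sup>p w\<close> modulo \<open>t\<^sup>n\<close> with \<open>w\<close> a unit, and for \<open>X = [1, y; 0, w]\<close> the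
  equation \<open>B X = X D\<close> has the solution with lower left parameter \<open>t\<^sup>p\<close> and diagonal
  \<open>a - t\<^sup>m\<^sup>-\<^sup>r y\<close>, \<open>d + t\<^sup>m\<^sup>-\<^sup>r y\<close>; the prescribed \<open>y\<close> cancels the top \<open>r\<close> coefficients of \<open>a\<close>
  (\<open>normalizing_series\<close>). The case \<open>c\<^sub>p = 0\<close> is reduced to this one by exchanging \<open>b\<close> with \<open>c\<close>, which
  reverses products and so replaces \<open>X\<^sup>-\<^sup>1 B X\<close> by \<open>X B X\<^sup>-\<^sup>1\<close> (\<open>intertwines_swap\<close>).

  Uniqueness. Similar pairs in canonical form have the same \<open>m\<close>, the nilpotency index of the first
  matrix, and the same \<open>n\<close>. So the similarity commutes with \<open>J\<^sub>m \<oplus> J\<^sub>n\<close> and is again a matrix \<open>T\<close>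
  (\<open>commutes_JJ_imp_T_ser\<close>), whose diagonal series are units. The lowest coefficients of \<open>b\<close> and \<open>c\<close> change
  only by nonzero factors (\<open>leading_coefficients_invariant\<close>), which fixes the rank and the type. For a given type the
  normalization of \<open>a\<close> gives \<open>a = a'\<close>, and the differences \<open>b - b'\<close> and \<open>d - d'\<close> solve a homogeneous linear
  system with invertible determinant (\<open>canonical_parameters_unique\<close>).
\<close>

section \<open>Divisibility by powers of the indeterminate\<close>

lemma X_power_dvd_iff: "fps_X ^ k dvd (f :: 'a::field fps) \<longleftrightarrow> (\<forall>i<k. fps_nth f i = 0)"
proof (cases "f = 0")
  case False
  have "fps_X ^ k dvd f \<longleftrightarrow> k \<le> subdegree f"
    using False by (simp add: fps_dvd_iff)
  also have "\<dots> \<longleftrightarrow> (\<forall>i<k. fps_nth f i = 0)"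
    using False subdegree_geI[of f k] nth_less_subdegree_zero[of _ f]
    by (meson order.strict_trans2)
  finally show ?thesis .
qed auto

lemma X_power_dvd_unit_mult_iff:
  assumes "fps_nth (u :: 'a::field fps) 0 \<noteq> 0"
  shows "fps_X ^ k dvd u * f \<longleftrightarrow> fps_X ^ k dvd f"
  using assms by (intro dvd_mult_unit_iff') simp

lemma X_power_dvd_mult:
  assumes "fps_X ^ i dvd (f :: 'a::field fps)" "fps_X ^ j dvd g" "k \<le> i + j"
  shows "fps_X ^ k dvd f * g"
  using dvd_trans[OF le_imp_power_dvd[OF assms(3)]] mult_dvd_mono[OF assms(1,2)]
  unfolding power_add by blast

lemma X_power_dvd_le: "fps_X ^ j dvd (f :: 'a::field fps) \<Longrightarrow> i \<le> j \<Longrightarrow> fps_X ^ i dvd f"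
  by (rule power_le_dvd)

lemma X_power_dvd_cancel:
  "fps_X ^ (i + k) dvd fps_X ^ i * (f :: 'a::field fps) \<longleftrightarrow> fps_X ^ k dvd f"
  by (simp add: power_add)

lemma nth_mult_X_power_dvd:
  assumes "fps_X ^ p dvd (f :: 'a::field fps)"
  shows "fps_nth (f * g) p = fps_nth f p * fps_nth g 0"
proof -
  obtain h where "f = fps_X ^ p * h" using assms by (elim dvdE)
  then show ?thesis by (simp add: fps_X_power_mult_nth mult.assoc)
qed

section \<open>Intertwining relations between parameter series\<close>

text \<open>
  With \<open>t\<close> the indeterminate and \<open>s = m - n\<close>, these are the four entries of the matrix equation
  \<open>[a, b; t\<^sup>s c, d] [x, y; t\<^sup>s z, w] = [x, y; t\<^sup>s z, w] [a', b'; t\<^sup>s c', d']\<close>, the lower left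
  one after division by \<open>t\<^sup>s\<close>. The first entry is read modulo \<open>t\<^sup>m\<close> and the others modulo \<open>t\<^sup>n\<close>,
  because these are the coefficients that a matrix \<open>T\<close> records.
\<close>
definition intertwines ::
  "nat \<Rightarrow> nat \<Rightarrow> 'a::field fps \<Rightarrow> 'a fps \<Rightarrow> 'a fps \<Rightarrow> 'a fps \<Rightarrow>
   'a fps \<Rightarrow> 'a fps \<Rightarrow> 'a fps \<Rightarrow> 'a fps \<Rightarrow>
   'a fps \<Rightarrow> 'a fps \<Rightarrow> 'a fps \<Rightarrow> 'a fps \<Rightarrow> bool" where
  "intertwines m n a b c d x y z w a' b' c' d' \<longleftrightarrow>
     fps_X ^ m dvd (a * x + fps_X ^ (m - n) * b * z) - (x * a' + fps_X ^ (m - n) * y * c') \<and>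
     fps_X ^ n dvd (a * y + b * w) - (x * b' + y * d') \<and>
     fps_X ^ n dvd (c * x + d * z) - (z * a' + w * c') \<and>
     fps_X ^ n dvd (fps_X ^ (m - n) * c * y + d * w) - (fps_X ^ (m - n) * z * b' + w * d')"

text \<open>
  Exchanging the two off-diagonal parameters is the transpose, conjugated by the diagonal matrix with
  entries \<open>1, t\<^sup>s\<close>; it therefore reverses products and turns \<open>B X = X D\<close> into a relation with the
  roles of \<open>B\<close> and \<open>D\<close> exchanged. This symmetry reduces every statement about the type
  \<open>B'\<^bsub>m,n,r\<^esub>\<close> to the type \<open>B\<^bsub>m,n,r\<^esub>\<close>.
\<close>
lemma intertwines_swap:
  assumes "intertwines m n a b c d x y z w a' b' c' d'"
  shows "intertwines m n a' c' b' d' x z y w a c b d"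
proof -
  have neg: "v dvd u \<Longrightarrow> u' = - u \<Longrightarrow> v dvd u'" for u u' v :: "'a::field fps"
    by simp
  note int = assms[unfolded intertwines_def]
  show ?thesis
    unfolding intertwines_def
  proof (intro conjI)
    show "fps_X ^ m dvd (a' * x + fps_X ^ (m - n) * c' * y) - (x * a + fps_X ^ (m - n) * z * b)"
      by (rule neg[OF int[THEN conjunct1]]) (simp add: algebra_simps)
    show "fps_X ^ n dvd (a' * z + c' * w) - (x * c + z * d)"
      by (rule neg[OF int[THEN conjunct2, THEN conjunct2, THEN conjunct1]]) (simp add: algebra_simps)
    show "fps_X ^ n dvd (b' * x + d' * y) - (y * a + w * b)"
      by (rule neg[OF int[THEN conjunct2, THEN conjunct1]]) (simp add: algebra_simps)
    show "fps_X ^ n dvd (fps_X ^ (m - n) * b' * z + d' * w) - (fps_X ^ (m - n) * y * c + w * d)"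
      by (rule neg[OF int[THEN conjunct2, THEN conjunct2, THEN conjunct2]]) (simp add: algebra_simps)
  qed
qed

text \<open>
  The diagonal series \<open>a, d, a', d'\<close> all agree modulo \<open>t\<^sup>p\<^sup>+\<^sup>1\<close>, so modulo this power they cancel from
  the two off-diagonal equations, of which only \<open>b w = x b'\<close> and \<open>c x = w c'\<close> remain. For
  invertible \<open>x\<close> and \<open>w\<close> it follows that similar matrices have the same canonical rank, and that
  which of the two leading coefficients vanish does not change.
\<close>
lemma leading_coefficients_invariant:
  fixes a b c d :: "'a::field fps"
  assumes "n < m" "p < n"
    and int: "intertwines m n a b c d x y z w a' b' c' d'"
    and b: "fps_X ^ p dvd b" and c: "fps_X ^ p dvd c"
    and b': "fps_X ^ p dvd b'" and c': "fps_X ^ p dvd c'"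
    and ad: "fps_X ^ (p + 1) dvd a - d" and ad': "fps_X ^ (p + 1) dvd a' - d'"
    and x: "fps_nth x 0 \<noteq> 0"
  shows "fps_nth b p * fps_nth w 0 = fps_nth b' p * fps_nth x 0"
    and "fps_nth c p * fps_nth x 0 = fps_nth c' p * fps_nth w 0"
proof -
  let ?X = "fps_X :: 'a fps"
  have pm: "p + 1 \<le> m" and pn: "p + 1 \<le> n"
    using assms(1,2) by auto
  have e11: "?X ^ (p + 1) dvd (a * x + ?X ^ (m - n) * b * z) - (x * a' + ?X ^ (m - n) * y * c')"
    and e12: "?X ^ (p + 1) dvd (a * y + b * w) - (x * b' + y * d')"
    and e21: "?X ^ (p + 1) dvd (c * x + d * z) - (z * a' + w * c')"
    using int[unfolded intertwines_def] X_power_dvd_le[OF _ pm] X_power_dvd_le[OF _ pn] by blast+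
  have tb: "?X ^ (p + 1) dvd ?X ^ (m - n) * b"
    by (rule X_power_dvd_mult[OF dvd_refl b]) (use assms(1) in simp)
  have tc: "?X ^ (p + 1) dvd ?X ^ (m - n) * c'"
    by (rule X_power_dvd_mult[OF dvd_refl c']) (use assms(1) in simp)
  have "?X ^ (p + 1) dvd ((a * x + ?X ^ (m - n) * b * z) - (x * a' + ?X ^ (m - n) * y * c'))
      - (?X ^ (m - n) * b) * z + (?X ^ (m - n) * c') * y"
    by (rule dvd_add[OF dvd_diff[OF e11 dvd_mult2[OF tb]] dvd_mult2[OF tc]])
  also have "\<dots> = x * (a - a')"
    by (simp add: algebra_simps)
  finally have aa: "?X ^ (p + 1) dvd a - a'"
    using X_power_dvd_unit_mult_iff[OF x] by blast
  have ad2: "?X ^ (p + 1) dvd a - d'"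
    using dvd_add[OF aa ad'] by simp
  have da2: "?X ^ (p + 1) dvd d - a'"
    using dvd_diff[OF aa ad] by simp
  have "?X ^ (p + 1) dvd ((a * y + b * w) - (x * b' + y * d')) - (a - d') * y"
    by (rule dvd_diff[OF e12 dvd_mult2[OF ad2]])
  then have "?X ^ (p + 1) dvd b * w - b' * x"
    by (simp add: algebra_simps)
  then have "fps_nth (b * w - b' * x) p = 0"
    unfolding X_power_dvd_iff by simp
  then show "fps_nth b p * fps_nth w 0 = fps_nth b' p * fps_nth x 0"
    by (simp add: nth_mult_X_power_dvd b b')
  have "?X ^ (p + 1) dvd ((c * x + d * z) - (z * a' + w * c')) - (d - a') * z"
    by (rule dvd_diff[OF e21 dvd_mult2[OF da2]])
  then have "?X ^ (p + 1) dvd c * x - c' * w"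
    by (simp add: algebra_simps)
  then have "fps_nth (c * x - c' * w) p = 0"
    unfolding X_power_dvd_iff by simp
  then show "fps_nth c p * fps_nth x 0 = fps_nth c' p * fps_nth w 0"
    by (simp add: nth_mult_X_power_dvd c c')
qed

text \<open>
  Uniqueness of the parameters for the type \<open>B\<^bsub>m,n,r\<^esub>\<close>, where \<open>p = n - r\<close>. The first entry of the
  intertwining relation determines \<open>a\<close> below degree \<open>s + p\<close>, and from that degree on \<open>a\<close> is
  normalized; hence \<open>a = a'\<close>. What is left of the first entry and of the lower left one expresses
  \<open>y\<close> and \<open>x - w\<close> through \<open>z\<close>. After this substitution the remaining two entries form a homogeneous linear
  system for \<open>b - b'\<close> and \<open>d - d'\<close> whose determinant \<open>w x - t\<^sup>s \<beta> z\<^sup>2\<close>, with \<open>b = t\<^sup>p \<beta>\<close>, has a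
  nonzero constant coefficient because \<open>s > 0\<close>.
\<close>
lemma canonical_parameters_unique:
  fixes a b d :: "'a::field fps"
  assumes "n < m" "p < n"
    and int: "intertwines m n a b c d x y z w a' b' c' d'"
    and b: "fps_X ^ p dvd b" and b': "fps_X ^ p dvd b'"
    and c: "fps_X ^ n dvd c - fps_X ^ p" and c': "fps_X ^ n dvd c' - fps_X ^ p"
    and ad: "fps_X ^ (p + 1) dvd a - d" and ad': "fps_X ^ (p + 1) dvd a' - d'"
    and top: "\<And>i. m - n + p \<le> i \<Longrightarrow> i < m \<Longrightarrow> fps_nth a i = fps_nth a' i"
    and x: "fps_nth x 0 \<noteq> 0" and w: "fps_nth w 0 \<noteq> 0"
  shows "fps_X ^ m dvd a - a'" "fps_X ^ n dvd b - b'" "fps_X ^ n dvd d - d'"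
proof -
  let ?X = "fps_X :: 'a fps"
  define t where "t = ?X ^ (m - n)"
  define q where "q = ?X ^ p"
  have m: "m = (m - n) + n" and n: "n = p + (n - p)"
    using assms(1,2) by auto
  have tn: "?X ^ m = t * ?X ^ n"
    unfolding t_def by (metis m power_add)
  have e11: "?X ^ m dvd (a * x + t * b * z) - (x * a' + t * y * c')"
    and e12: "?X ^ n dvd (a * y + b * w) - (x * b' + y * d')"
    and e21: "?X ^ n dvd (c * x + d * z) - (z * a' + w * c')"
    and e22: "?X ^ n dvd (t * c * y + d * w) - (t * z * b' + w * d')"
    using int unfolding intertwines_def t_def by auto
  have mn: "?X ^ n dvd f" if "?X ^ m dvd f" for f
    using that assms(1) by (auto intro: X_power_dvd_le)
  obtain \<beta> where \<beta>: "b = q * \<beta>" using b unfolding q_def by (elim dvdE)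
  have c'X: "?X ^ m dvd t * (c' - q)"
    unfolding tn q_def using c' by (intro mult_dvd_mono dvd_refl)
  have "?X ^ m dvd ((a * x + t * b * z) - (x * a' + t * y * c')) + t * (c' - q) * y"
    by (rule dvd_add[OF e11 dvd_mult2[OF c'X]])
  also have "\<dots> = x * (a - a') - t * (q * y - b * z)"
    by (simp add: algebra_simps)
  finally have f11: "?X ^ m dvd x * (a - a') - t * (q * y - b * z)" .
  \<comment> \<open>Below degree \<open>s + p\<close> the correction term vanishes; above it \<open>a\<close> and \<open>a'\<close> agree by \<open>top\<close>.\<close>
  have "?X ^ (m - n + p) dvd x * (a - a') - t * (q * y - b * z)"
    using f11 by (rule X_power_dvd_le) (use assms(1,2) in auto)
  moreover have "?X ^ (m - n + p) dvd t * (q * y - b * z)"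
    unfolding \<beta> power_add t_def[symmetric] q_def[symmetric]
    by (rule mult_dvd_mono) (auto simp: algebra_simps intro!: dvd_diff)
  ultimately have "?X ^ (m - n + p) dvd x * (a - a') - t * (q * y - b * z) + t * (q * y - b * z)"
    by (rule dvd_add)
  then have "?X ^ (m - n + p) dvd x * (a - a')" by simp
  then have "?X ^ (m - n + p) dvd a - a'"
    using X_power_dvd_unit_mult_iff[OF x] by blast
  then show aa: "?X ^ m dvd a - a'"
    using top unfolding X_power_dvd_iff by (metis fps_sub_nth eq_iff_diff_eq_0 not_le)
  have "?X ^ m dvd x * (a - a') - (x * (a - a') - t * (q * y - b * z))"
    by (rule dvd_diff[OF dvd_mult[OF aa] f11])
  then have "?X ^ m dvd t * (q * y - b * z)" by simp
  then have yb: "?X ^ n dvd q * y - b * z"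
    using X_power_dvd_cancel[of "m - n" n] m unfolding t_def by metis
  then have "?X ^ (p + (n - p)) dvd ?X ^ p * (y - \<beta> * z)"
    using n unfolding \<beta> q_def by (simp add: algebra_simps)
  then have y\<beta>: "?X ^ (n - p) dvd y - \<beta> * z"
    unfolding X_power_dvd_cancel .
  have "?X ^ n dvd ((c * x + d * z) - (z * a' + w * c')) - (c - q) * x + (c' - q) * w - z * (a - a')"
    by (rule dvd_diff[OF dvd_add[OF dvd_diff[OF e21 dvd_mult2[OF c[folded q_def]]] dvd_mult2[OF c'[folded q_def]]] dvd_mult[OF mn[OF aa]]])
  also have "\<dots> = q * (x - w) - z * (a - d)"
    by (simp add: algebra_simps)
  finally have xw: "?X ^ n dvd q * (x - w) - z * (a - d)" .
  have da: "?X ^ (p + 1) dvd d' - a"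
  proof -
    have "?X ^ (p + 1) dvd a - a'"
      using aa by (rule X_power_dvd_le) (use assms(1,2) in auto)
    from dvd_add[OF this ad'] show ?thesis by (simp add: dvd_diff_commute)
  qed
  \<comment> \<open>The congruence for \<open>y\<close> holds only modulo \<open>t\<^sup>n\<^sup>-\<^sup>p\<close>, but \<open>d' - a\<close> supplies the missing power of \<open>t\<close>.\<close>
  have "?X ^ n dvd (y - \<beta> * z) * (d' - a)"
    using y\<beta> da by (rule X_power_dvd_mult) auto
  then have "?X ^ n dvd ((a * y + b * w) - (x * b' + y * d')) + (y - \<beta> * z) * (d' - a)
       + \<beta> * (q * (x - w) - z * (a - d))"
    by (intro dvd_add[OF dvd_add[OF e12] dvd_mult[OF xw]])
  also have "\<dots> = (b - b') * x - \<beta> * z * (d' - d)"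
    unfolding \<beta> by (simp add: algebra_simps)
  finally have bb: "?X ^ n dvd (b - b') * x - \<beta> * z * (d' - d)" .
  have "?X ^ n dvd ((t * c * y + d * w) - (t * z * b' + w * d')) - (c - q) * (t * y) - (q * y - b * z) * t"
    by (rule dvd_diff[OF dvd_diff[OF e22 dvd_mult2[OF c[folded q_def]]] dvd_mult2[OF yb]])
  also have "\<dots> = w * (d - d') - t * z * (b' - b)"
    by (simp add: algebra_simps)
  finally have dd: "?X ^ n dvd w * (d - d') - t * z * (b' - b)" .
  \<comment> \<open>Eliminate \<open>d - d'\<close> from \<open>bb\<close> and \<open>dd\<close>.\<close>
  have "?X ^ n dvd w * ((b - b') * x - \<beta> * z * (d' - d)) - \<beta> * z * (w * (d - d') - t * z * (b' - b))"
    by (rule dvd_diff[OF dvd_mult[OF bb] dvd_mult[OF dd]])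
  also have "\<dots> = (w * x - t * (\<beta> * z * z)) * (b - b')"
    by (simp add: algebra_simps)
  finally show bb': "?X ^ n dvd b - b'"
    using assms(1) x w by (subst (asm) X_power_dvd_unit_mult_iff) (auto simp: t_def fps_X_power_mult_nth)
  have "?X ^ n dvd w * (d - d') - t * z * (b' - b) - t * z * (b - b')"
    by (rule dvd_diff[OF dd dvd_mult[OF bb']])
  also have "\<dots> = w * (d - d')"
    by (simp add: algebra_simps)
  finally show "?X ^ n dvd d - d'"
    using X_power_dvd_unit_mult_iff[OF w] by blast
qed

section \<open>The matrices as a ring of two-by-two matrices of power series\<close>

text \<open>
  The upper triangular Toeplitz block of a power series, shifted \<open>e\<close> columns to the right. All four
  blocks of a matrix \<open>T\<close> have this form; \<open>e = m - n\<close> occurs for the lower left one.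
\<close>
definition toep :: "nat \<Rightarrow> nat \<Rightarrow> nat \<Rightarrow> 'a::field fps \<Rightarrow> 'a mat" where
  "toep p q e f = mat p q (\<lambda>(i, j). if i + e \<le> j then fps_nth f (j - i - e) else 0)"

lemma toep_carrier [simp]: "toep p q e f \<in> carrier_mat p q"
  by (simp add: toep_def)

lemma toep_dim [simp]: "dim_row (toep p q e f) = p" "dim_col (toep p q e f) = q"
  by (simp_all add: toep_def)

text \<open>
  Toeplitz blocks multiply by convolution provided that the sum over the middle index is not cut off
  at \<open>q\<close>: the nonzero terms in column \<open>j\<close> have index at most \<open>j - e'\<close>, which is where the bound on \<open>r\<close>
  comes from.
\<close>
lemma toep_mult:
  assumes "r \<le> q + e'"
  shows "toep p q e f * toep q r e' g = toep p r (e + e') (f * g)"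
proof (rule eq_matI)
  fix i j assume "i < dim_row (toep p r (e + e') (f * g))" "j < dim_col (toep p r (e + e') (f * g))"
  then have ij: "i < p" "j < r" by simp_all
  let ?F = "\<lambda>k. (if i + e \<le> k then fps_nth f (k - i - e) else 0) *
      (if k + e' \<le> j then fps_nth g (j - k - e') else 0)"
  have "(toep p q e f * toep q r e' g) $$ (i, j) = (\<Sum>k = 0..<q. ?F k)"
    using ij by (simp add: toep_def scalar_prod_def)
  also have "\<dots> = toep p r (e + e') (f * g) $$ (i, j)"
  proof (cases "i + (e + e') \<le> j")
    case True
    let ?l = "j - i - (e + e')"
    have "(\<Sum>k = 0..<q. ?F k) = (\<Sum>k \<in> {i + e..i + e + ?l}. ?F k)"
      using True ij assms by (intro sum.mono_neutral_right) auto
    also have "\<dots> = (\<Sum>k \<in> {0..?l}. fps_nth f k * fps_nth g (?l - k))"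
      by (rule sum.reindex_bij_witness[of _ "\<lambda>k. k + (i + e)" "\<lambda>k. k - (i + e)"])
        (use True in \<open>auto simp: diff_diff_left add_ac\<close>)
    also have "\<dots> = toep p r (e + e') (f * g) $$ (i, j)"
      using True ij by (simp add: toep_def fps_mult_nth)
    finally show ?thesis .
  next
    case False
    then have "(\<Sum>k = 0..<q. ?F k) = 0"
      by (intro sum.neutral) auto
    then show ?thesis using False ij by (simp add: toep_def)
  qed
  finally show "(toep p q e f * toep q r e' g) $$ (i, j) = toep p r (e + e') (f * g) $$ (i, j)" .
qed auto

lemma toep_add: "toep p q e f + toep p q e g = toep p q e (f + g)"
  by (rule eq_matI) (auto simp: toep_def)

lemma toep_X_power_mult: "toep p q e (fps_X ^ s * f) = toep p q (e + s) f"
  by (rule eq_matI) (auto simp: toep_def fps_X_power_mult_nth diff_diff_left add.assoc)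

lemma toep_eq_iff:
  assumes "0 < p"
  shows "toep p q e f = toep p q e g \<longleftrightarrow> fps_X ^ (q - e) dvd f - g"
proof
  assume eq: "toep p q e f = toep p q e g"
  show "fps_X ^ (q - e) dvd f - g"
    unfolding X_power_dvd_iff
  proof (intro allI impI)
    fix i assume "i < q - e"
    then show "fps_nth (f - g) i = 0"
      using arg_cong[OF eq, of "\<lambda>M. M $$ (0, i + e)"] assms by (auto simp: toep_def)
  qed
next
  assume "fps_X ^ (q - e) dvd f - g"
  then have "fps_nth f i = fps_nth g i" if "i < q - e" for i
    using that unfolding X_power_dvd_iff by simp
  then show "toep p q e f = toep p q e g"
    by (intro eq_matI) (auto simp: toep_def)
qed

lemma four_block_mat_eq_iff:
  assumes "P \<in> carrier_mat p q" "Q \<in> carrier_mat p q'" "R \<in> carrier_mat p' q" "S \<in> carrier_mat p' q'"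
    and "P' \<in> carrier_mat p q" "Q' \<in> carrier_mat p q'" "R' \<in> carrier_mat p' q" "S' \<in> carrier_mat p' q'"
  shows "four_block_mat P Q R S = four_block_mat P' Q' R' S' \<longleftrightarrow> P = P' \<and> Q = Q' \<and> R = R' \<and> S = S'"
proof
  assume eq: "four_block_mat P Q R S = four_block_mat P' Q' R' S'"
  have entry: "four_block_mat P Q R S $$ (i, j) = four_block_mat P' Q' R' S' $$ (i, j)" for i j
    using eq by simp
  show "P = P' \<and> Q = Q' \<and> R = R' \<and> S = S'"
  proof (intro conjI)
    show "P = P'"
    proof (rule eq_matI)
      fix i j assume "i < dim_row P'" "j < dim_col P'"
      then show "P $$ (i, j) = P' $$ (i, j)" using entry[of i j] assms by auto
    qed (use assms in auto)
    show "Q = Q'"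
    proof (rule eq_matI)
      fix i j assume "i < dim_row Q'" "j < dim_col Q'"
      then show "Q $$ (i, j) = Q' $$ (i, j)" using entry[of i "j + q"] assms by auto
    qed (use assms in auto)
    show "R = R'"
    proof (rule eq_matI)
      fix i j assume "i < dim_row R'" "j < dim_col R'"
      then show "R $$ (i, j) = R' $$ (i, j)" using entry[of "i + p" j] assms by auto
    qed (use assms in auto)
    show "S = S'"
    proof (rule eq_matI)
      fix i j assume "i < dim_row S'" "j < dim_col S'"
      then show "S $$ (i, j) = S' $$ (i, j)" using entry[of "i + p" "j + q"] assms by auto
    qed (use assms in auto)
  qed
qed simp

definition T_ser ::
  "nat \<Rightarrow> nat \<Rightarrow> 'a::field fps \<Rightarrow> 'a fps \<Rightarrow> 'a fps \<Rightarrow> 'a fps \<Rightarrow> 'a mat" where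
  "T_ser m n a b c d = T_mat m n (fps_nth a) (fps_nth b) (fps_nth c) (fps_nth d)"

lemma T_mat_eq_T_ser: "T_mat m n a b c d = T_ser m n (Abs_fps a) (Abs_fps b) (Abs_fps c) (Abs_fps d)"
  by (simp add: T_ser_def Abs_fps_inverse)

lemma T_ser_blocks:
  "T_ser m n a b c d =
     four_block_mat (toep m m 0 a) (toep m n 0 b) (toep n m (m - n) c) (toep n n 0 d)"
  unfolding T_ser_def T_mat_def toep_def Let_def
  by (simp add: diff_diff_left add.commute cong: if_cong)

lemma T_ser_carrier [simp]: "T_ser m n a b c d \<in> carrier_mat (m + n) (m + n)"
  unfolding T_ser_blocks by simp

text \<open>
  The product formula of \<open>[a, b; t\<^sup>s c, d]\<close> over power series. It lets all further computations with the
  matrices be carried out in a commutative ring.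
\<close>
lemma T_ser_mult:
  assumes "n \<le> m"
  shows "T_ser m n a b c d * T_ser m n a' b' c' d' =
     T_ser m n (a * a' + fps_X ^ (m - n) * b * c') (a * b' + b * d')
       (c * a' + d * c') (fps_X ^ (m - n) * c * b' + d * d')"
proof -
  have e: "toep m m (m - n) f = toep m m 0 (fps_X ^ (m - n) * f)"
    "toep n n (m - n) f = toep n n 0 (fps_X ^ (m - n) * f)" for f :: "'a fps"
    by (simp_all add: toep_X_power_mult)
  show ?thesis
    unfolding T_ser_blocks
    by (subst mult_four_block_mat[OF toep_carrier toep_carrier toep_carrier toep_carrier
          toep_carrier toep_carrier toep_carrier toep_carrier])
      (use assms in \<open>simp add: toep_mult toep_add e mult.assoc\<close>)
qed

lemma T_ser_eq_iff:
  assumes "0 < n" "n < m"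
  shows "T_ser m n a b c d = T_ser m n a' b' c' d' \<longleftrightarrow>
     fps_X ^ m dvd a - a' \<and> fps_X ^ n dvd b - b' \<and> fps_X ^ n dvd c - c' \<and> fps_X ^ n dvd d - d'"
  unfolding T_ser_blocks
  by (subst four_block_mat_eq_iff[OF toep_carrier toep_carrier toep_carrier toep_carrier
        toep_carrier toep_carrier toep_carrier toep_carrier])
    (use assms in \<open>simp add: toep_eq_iff\<close>)

lemma one_mat_eq_T_ser: "1\<^sub>m (m + n) = T_ser m n 1 0 0 1"
  unfolding T_ser_blocks by (rule eq_matI) (auto simp: toep_def)

lemma zero_mat_eq_T_ser: "0\<^sub>m (m + n) (m + n) = T_ser m n 0 0 0 0"
  unfolding T_ser_blocks by (rule eq_matI) (auto simp: toep_def)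

lemma JJ_blocks: "JJ m n = four_block_mat (jordan_block m 0) (0\<^sub>m m n) (0\<^sub>m n m) (jordan_block n 0)"
  by (simp add: diag_block_mat.simps(2)[of _ "[_]"] Let_def del: diag_block_mat.simps)

lemma JJ_eq_T_ser: "JJ m n = T_ser m n fps_X 0 0 fps_X"
proof -
  have "jordan_block k 0 = toep k k 0 (fps_X :: 'a fps)" for k
    by (rule eq_matI) (auto simp: toep_def fps_X_def)
  moreover have "0\<^sub>m k l = toep k l e (0 :: 'a fps)" for k l e
    by (rule eq_matI) (auto simp: toep_def)
  ultimately show ?thesis
    unfolding JJ_blocks T_ser_blocks by metis
qed

lemma JJ_carrier: "JJ m n \<in> carrier_mat (m + n) (m + n)"
  unfolding JJ_eq_T_ser by simp

lemma JJ_commutes_T_ser: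
  assumes "n \<le> m"
  shows "JJ m n * T_ser m n a b c d = T_ser m n a b c d * JJ m n"
  using assms by (simp add: JJ_eq_T_ser T_ser_mult mult.commute del: diag_block_mat.simps)

lemma mult_T_ser_eq_iff_intertwines:
  assumes "0 < n" "n < m"
  shows "T_ser m n a b c d * T_ser m n x y z w = T_ser m n x y z w * T_ser m n a' b' c' d' \<longleftrightarrow>
     intertwines m n a b c d x y z w a' b' c' d'"
  using assms by (simp add: T_ser_mult T_ser_eq_iff intertwines_def)

section \<open>The commutant of two Jordan blocks\<close>

text \<open>
  Commutation says that \<open>Y\<close> is constant along diagonals, with entries outside the matrix read as zero.
  So a diagonal vanishes as soon as it leaves the matrix through the first column or through the last
  row, and the remaining ones form a Toeplitz block with shift \<open>q - p\<close> (truncated subtraction covers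
  the case \<open>q \<le> p\<close>).
\<close>
lemma commutes_jordan_block_imp_toep:
  assumes Y: "Y \<in> carrier_mat p q"
    and comm: "jordan_block p 0 * Y = Y * jordan_block q (0 :: 'a::field)"
  shows "\<exists>f. Y = toep p q (q - p) f"
proof -
  have entry: "(if Suc i < p then Y $$ (Suc i, j) else 0) = (if 0 < j then Y $$ (i, j - 1) else 0)"
    if "i < p" "j < q" for i j
  proof -
    have "(jordan_block p 0 * Y) $$ (i, j) = (\<Sum>k = 0..<p. jordan_block p 0 $$ (i, k) * Y $$ (k, j))"
      using that Y by (simp add: scalar_prod_def)
    also have "\<dots> = (\<Sum>k = 0..<p. if k = Suc i then Y $$ (k, j) else 0)"
      using that by (intro sum.cong) auto
    finally have l: "(jordan_block p 0 * Y) $$ (i, j) = (if Suc i < p then Y $$ (Suc i, j) else 0)"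
      by simp
    have "(Y * jordan_block q 0) $$ (i, j) = (\<Sum>k = 0..<q. Y $$ (i, k) * jordan_block q 0 $$ (k, j))"
      using that Y by (simp add: scalar_prod_def)
    also have "\<dots> = (\<Sum>k = 0..<q. if k = j - 1 then (if 0 < j then Y $$ (i, j - 1) else 0) else 0)"
      using that by (intro sum.cong) auto
    finally have "(Y * jordan_block q 0) $$ (i, j) = (if 0 < j then Y $$ (i, j - 1) else 0)"
      using that by simp
    with l show ?thesis using comm by simp
  qed
  have shift: "k \<le> i \<Longrightarrow> k \<le> j \<Longrightarrow> Y $$ (i, j) = Y $$ (i - k, j - k)" if "i < p" "j < q" for i j k
  proof (induction k)
    case (Suc k)
    have "Suc (i - Suc k) = i - k" "i - k < p" "i - Suc k < p" "j - k < q" "0 < j - k" "j - k - 1 = j - Suc k"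
      using Suc.prems that by auto
    then show ?case
      using entry[of "i - Suc k" "j - k"] Suc by simp
  qed simp
  have below: "Y $$ (i, 0) = 0" if "0 < i" "i < p" "0 < q" for i
    using entry[of "i - 1" 0] that by simp
  have last: "Y $$ (p - 1, j) = 0" if "Suc j < q" "0 < p" for j
    using entry[of "p - 1" "Suc j"] that by simp
  have "Y = toep p q (q - p) (Abs_fps (\<lambda>k. Y $$ (0, k + (q - p))))"
  proof (rule eq_matI)
    fix i j
    assume "i < dim_row (toep p q (q - p) (Abs_fps (\<lambda>k. Y $$ (0, k + (q - p)))))"
      "j < dim_col (toep p q (q - p) (Abs_fps (\<lambda>k. Y $$ (0, k + (q - p)))))"
    then have ij: "i < p" "j < q" by auto
    consider "i + (q - p) \<le> j" | "i \<le> j" "j < i + (q - p)" | "j < i" by linarith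
    then have "Y $$ (i, j) = (if i + (q - p) \<le> j then Y $$ (0, j - i) else 0)"
    proof cases
      case 1
      then show ?thesis using shift[OF ij, of i] by simp
    next
      case 2
      have "Y $$ (p - 1, j + (p - 1 - i)) = 0" using last[of "j + (p - 1 - i)"] 2 ij by auto
      moreover have "Y $$ (p - 1, j + (p - 1 - i)) = Y $$ (i, j)"
        using shift[of "p - 1" "j + (p - 1 - i)" "p - 1 - i"] 2 ij by auto
      ultimately show ?thesis using 2 by simp
    next
      case 3
      then show ?thesis using shift[OF ij, of j] below[of "i - j"] ij by simp
    qed
    then show "Y $$ (i, j) = toep p q (q - p) (Abs_fps (\<lambda>k. Y $$ (0, k + (q - p)))) $$ (i, j)"
      using ij by (auto simp: toep_def)
  qed (use Y in auto)
  then show ?thesis by blast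
qed

lemma commutes_JJ_imp_T_ser:
  assumes "n \<le> m" and Y: "Y \<in> carrier_mat (m + n) (m + n)"
    and comm: "JJ m n * Y = Y * JJ m n"
  shows "\<exists>x y z w. Y = T_ser m n x y z w"
proof -
  obtain P Q R S where s: "split_block Y m m = (P, Q, R, S)"
    by (metis prod_cases4)
  have PQRS: "P \<in> carrier_mat m m" "Q \<in> carrier_mat m n" "R \<in> carrier_mat n m" "S \<in> carrier_mat n n"
    and Y: "Y = four_block_mat P Q R S"
    using split_block[OF s, of n n] Y by auto
  let ?J = "\<lambda>k. jordan_block k (0 :: 'a)"
  have "four_block_mat (?J m * P) (?J m * Q) (?J n * R) (?J n * S) = JJ m n * Y"
    unfolding Y JJ_blocks
    by (subst mult_four_block_mat[of _ m m _ n _ n _ _ m _ n]) (use PQRS in auto)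
  also have "\<dots> = four_block_mat (P * ?J m) (Q * ?J n) (R * ?J m) (S * ?J n)"
    unfolding comm unfolding Y JJ_blocks
    by (subst mult_four_block_mat[of _ m m _ n _ n _ _ m _ n]) (use PQRS in auto)
  finally have "?J m * P = P * ?J m \<and> ?J m * Q = Q * ?J n \<and> ?J n * R = R * ?J m \<and> ?J n * S = S * ?J n"
    by (subst (asm) four_block_mat_eq_iff[of _ m m _ n _ n]) (use PQRS in \<open>auto intro: mult_carrier_mat\<close>)
  then obtain x y z w where "P = toep m m (m - m) x" "Q = toep m n (n - m) y"
      "R = toep n m (m - n) z" "S = toep n n (n - n) w"
    using PQRS commutes_jordan_block_imp_toep by metis
  then show ?thesis
    using assms(1) unfolding Y T_ser_blocks by auto
qed

text \<open>
  Modulo \<open>t\<close> the matrix \<open>[x, y; t\<^sup>s z, w]\<close> is upper triangular, so invertibility forces both diagonal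
  constant coefficients to be nonzero.
\<close>
lemma T_ser_mult_eq_one_imp:
  assumes "0 < n" "n < m" and "T_ser m n x y z w * T_ser m n x' y' z' w' = 1\<^sub>m (m + n)"
  shows "fps_nth x 0 \<noteq> 0" "fps_nth w 0 \<noteq> 0"
proof -
  have "fps_X ^ m dvd (x * x' + fps_X ^ (m - n) * y * z') - 1"
    "fps_X ^ n dvd (fps_X ^ (m - n) * z * y' + w * w') - 1"
    using assms by (simp_all add: one_mat_eq_T_ser T_ser_mult T_ser_eq_iff)
  then have "fps_nth ((x * x' + fps_X ^ (m - n) * y * z') - 1) 0 = 0"
    "fps_nth ((fps_X ^ (m - n) * z * y' + w * w') - 1) 0 = 0"
    using assms(1,2) unfolding X_power_dvd_iff by auto
  then show "fps_nth x 0 \<noteq> 0" "fps_nth w 0 \<noteq> 0"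
    using assms(1,2) by auto
qed

lemma JJ_power: 
  assumes "n \<le> m"
  shows "(JJ m n :: 'a::field mat) ^\<^sub>m k = T_ser m n (fps_X ^ k) 0 0 (fps_X ^ k)"
proof (induction k)
  case 0
  have "dim_row (JJ m n :: 'a mat) = m + n" using JJ_carrier by blast
  then show ?case by (simp add: one_mat_eq_T_ser del: diag_block_mat.simps)
next
  case (Suc k)
  then show ?case
    using assms
    by (simp add: T_ser_mult JJ_eq_T_ser mult.commute del: diag_block_mat.simps)
qed

lemma JJ_power_eq_zero_iff:
  assumes "0 < n" "n < m"
  shows "(JJ m n :: 'a::field mat) ^\<^sub>m k = 0\<^sub>m (m + n) (m + n) \<longleftrightarrow> m \<le> k"
  using assms
  by (auto simp: JJ_power zero_mat_eq_T_ser T_ser_eq_iff X_power_dvd_iff not_le simp del: diag_block_mat.simps)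

text \<open>
  The larger block size is the nilpotency index, hence a similarity invariant.
\<close>
lemma similar_JJ_imp_eq:
  assumes "0 < n" "n < m" "0 < n'" "n' < m'"
    and sim: "similar_mat_wit (JJ m n :: 'a::field mat) (JJ m' n') P Q"
  shows "m = m'" "n = n'"
proof -
  have sum: "m + n = m' + n'"
    using similar_mat_witD2[OF JJ_carrier sim] JJ_carrier[of m' n', where 'a = 'a] by auto
  have zero: "A ^\<^sub>m k = 0\<^sub>m N N"
    if "similar_mat_wit A C P Q" "A \<in> carrier_mat N N" "C ^\<^sub>m k = 0\<^sub>m N N" for A C P Q :: "'a mat" and N k
  proof -
    note wit = similar_mat_witD2[OF that(2,1)]
    have "A ^\<^sub>m k = P * 0\<^sub>m N N * Q"
      using similar_mat_wit_pow_id[OF that(1), of k] that(3) by simp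
    then show ?thesis
      using wit(6,7) by simp
  qed
  have "(JJ m n :: 'a mat) ^\<^sub>m k = 0\<^sub>m (m + n) (m + n) \<longleftrightarrow> (JJ m' n' :: 'a mat) ^\<^sub>m k = 0\<^sub>m (m + n) (m + n)" for k
    using zero[OF sim JJ_carrier, of k] zero[OF similar_mat_wit_sym[OF sim], of "m + n" k]
      JJ_carrier[of m' n', where 'a = 'a] unfolding sum by blast
  then have "m \<le> k \<longleftrightarrow> m' \<le> k" for k
    using JJ_power_eq_zero_iff assms(1-4) sum by metis
  then show "m = m'" by (metis order.eq_iff)
  then show "n = n'" using sum by simp
qed

section \<open>Uniqueness of canonical forms\<close>

text \<open>
  The canonical form in terms of series. The index \<open>p = n - r\<close> replaces the canonical rank since it is
  the exact power of \<open>t\<close> dividing both \<open>b\<close> and \<open>c\<close>.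
\<close>
definition canonical_series ::
  "nat \<Rightarrow> nat \<Rightarrow> nat \<Rightarrow> 'a::field fps \<Rightarrow> 'a fps \<Rightarrow> 'a fps \<Rightarrow> 'a fps \<Rightarrow> bool" where
  "canonical_series m n p a b c d \<longleftrightarrow>
     p < n \<and> n < m \<and> fps_nth a 0 = 0 \<and>
     (\<forall>i. m - n + p \<le> i \<longrightarrow> i < m \<longrightarrow> fps_nth a i = 0) \<and>
     fps_X ^ (p + 1) dvd a - d \<and> fps_X ^ p dvd b \<and> fps_X ^ p dvd c \<and>
     (fps_X ^ n dvd c - fps_X ^ p \<or> fps_X ^ n dvd b - fps_X ^ p \<and> fps_nth c p = 0)"

lemma in_canonical_form_iff:
  "in_canonical_form A B \<longleftrightarrow>
     (\<exists>m n p a b c d. canonical_series m n p a b c d \<and> A = JJ m n \<and> B = T_ser m n a b c d)"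
proof
  assume "in_canonical_form A B"
  then obtain m n r a b c d where
      r: "n < m" "1 \<le> r" "r \<le> n" and A: "A = JJ m n" and B: "B = T_mat m n a b c d"
      and a: "a 0 = 0" "\<And>i. m - r \<le> i \<Longrightarrow> i \<le> m - 1 \<Longrightarrow> a i = 0" "\<And>i. i \<le> n - r \<Longrightarrow> d i = a i"
      and type: "type_B n r b c \<or> type_B' n r b c"
    unfolding in_canonical_form_def by auto
  have "canonical_series m n (n - r) (Abs_fps a) (Abs_fps b) (Abs_fps c) (Abs_fps d)"
    unfolding canonical_series_def X_power_dvd_iff
    using r a type by (auto simp: type_B_def type_B'_def)
  then show "\<exists>m n p a b c d. canonical_series m n p a b c d \<and> A = JJ m n \<and> B = T_ser m n a b c d"
    using A B[unfolded T_mat_eq_T_ser] by blast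
next
  assume "\<exists>m n p a b c d. canonical_series m n p a b c d \<and> A = JJ m n \<and> B = T_ser m n a b c d"
  then obtain m n p a b c d where can: "canonical_series m n p a b c d"
      and A: "A = JJ m n" and B: "B = T_ser m n a b c d"
    by blast
  have p: "p < n" "n < m" "m - (n - p) = m - n + p" "n - (n - p) = p"
    using can by (auto simp: canonical_series_def)
  have a: "fps_nth a 0 = 0" "\<forall>i. m - (n - p) \<le> i \<and> i \<le> m - 1 \<longrightarrow> fps_nth a i = 0"
    "\<forall>i \<le> n - (n - p). fps_nth d i = fps_nth a i"
    using can p unfolding canonical_series_def X_power_dvd_iff by auto
  have type: "type_B n (n - p) (fps_nth b) (fps_nth c) \<or> type_B' n (n - p) (fps_nth b) (fps_nth c)"
  proof (cases "fps_X ^ n dvd c - fps_X ^ p")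
    case True
    then have "type_B n (n - p) (fps_nth b) (fps_nth c)"
      using can p unfolding canonical_series_def X_power_dvd_iff type_B_def by auto
    then show ?thesis ..
  next
    case False
    then have "fps_X ^ n dvd b - fps_X ^ p" "fps_X ^ p dvd c" "fps_nth c p = 0"
      using can unfolding canonical_series_def by auto
    then have "type_B' n (n - p) (fps_nth b) (fps_nth c)"
      using p unfolding X_power_dvd_iff type_B'_def by (auto simp: le_less)
    then show ?thesis ..
  qed
  have bounds: "1 \<le> n" "1 \<le> n - p" "n - p \<le> n"
    using p by auto
  show "in_canonical_form A B"
    unfolding in_canonical_form_def
    by (rule exI[of _ m], rule exI[of _ n], rule exI[of _ "n - p"], rule exI[of _ "fps_nth a"],
        rule exI[of _ "fps_nth b"], rule exI[of _ "fps_nth c"], rule exI[of _ "fps_nth d"], intro conjI)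
      (fact bounds p(2) a A B[unfolded T_ser_def] type)+
qed

text \<open>
  The minimum of \<open>p\<close> and \<open>p'\<close> satisfies the hypotheses on the common power of \<open>t\<close>, and comparing the
  coefficients at this index gives first \<open>p = p'\<close> and then equality of types. The second type follows
  from the first by exchanging the off-diagonal parameters.
\<close>
lemma canonical_series_unique:
  assumes can: "canonical_series m n p a b c d" and can': "canonical_series m n p' a' b' c' d'"
    and int: "intertwines m n a b c d x y z w a' b' c' d'"
    and x: "fps_nth x 0 \<noteq> 0" and w: "fps_nth w 0 \<noteq> 0"
  shows "T_ser m n a b c d = T_ser m n a' b' c' d'"
proof -
  have nm: "n < m" "p < n" "p' < n" "0 < n"
    using can can' by (auto simp: canonical_series_def)
  let ?q = "min p p'"
  have q: "fps_X ^ ?q dvd b" "fps_X ^ ?q dvd c" "fps_X ^ ?q dvd b'" "fps_X ^ ?q dvd c'"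
    "fps_X ^ (?q + 1) dvd a - d" "fps_X ^ (?q + 1) dvd a' - d'"
    using can can' unfolding canonical_series_def X_power_dvd_iff by auto
  have lead: "fps_nth b ?q = 0 \<longleftrightarrow> fps_nth b' ?q = 0" "fps_nth c ?q = 0 \<longleftrightarrow> fps_nth c' ?q = 0"
    using leading_coefficients_invariant[OF nm(1) _ int q x] nm x w by auto
  have lead_p: "fps_nth c p \<noteq> 0 \<or> fps_nth b p \<noteq> 0" "fps_nth c' p' \<noteq> 0 \<or> fps_nth b' p' \<noteq> 0"
    using can can' unfolding canonical_series_def X_power_dvd_iff by auto
  have "p = p'"
  proof (rule linorder_cases[of p p'])
    assume "p < p'"
    then have "fps_nth b' p = 0" "fps_nth c' p = 0"
      using can' unfolding canonical_series_def X_power_dvd_iff by auto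
    then show ?thesis using lead lead_p \<open>p < p'\<close> by auto
  next
    assume "p' < p"
    then have "fps_nth b p' = 0" "fps_nth c p' = 0"
      using can unfolding canonical_series_def X_power_dvd_iff by auto
    then show ?thesis using lead lead_p \<open>p' < p\<close> by auto
  qed
  then have can': "canonical_series m n p a' b' c' d'" using can' by simp
  have c_iff: "fps_X ^ n dvd c - fps_X ^ p \<longleftrightarrow> fps_X ^ n dvd c' - fps_X ^ p"
  proof -
    have "fps_X ^ n dvd e - fps_X ^ p \<longleftrightarrow> fps_nth e p \<noteq> 0" if "canonical_series m n p f g e h" for e f g h :: "'a fps"
      using that nm unfolding canonical_series_def X_power_dvd_iff by auto
    then show ?thesis using lead(2) can can' \<open>p = p'\<close> by simp
  qed
  have top: "fps_nth a i = fps_nth a' i" if "m - n + p \<le> i" "i < m" for i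
    using can can' that by (simp add: canonical_series_def)
  have "fps_X ^ m dvd a - a' \<and> fps_X ^ n dvd b - b' \<and> fps_X ^ n dvd c - c' \<and> fps_X ^ n dvd d - d'"
  proof (cases "fps_X ^ n dvd c - fps_X ^ p")
    case True
    then have c: "fps_X ^ n dvd c - fps_X ^ p" "fps_X ^ n dvd c' - fps_X ^ p"
      using c_iff by auto
    then have "fps_X ^ n dvd c - c'"
      using dvd_diff[OF c] by simp
    then show ?thesis
      using canonical_parameters_unique[OF nm(1,2) int _ _ c _ _ top x w] can can'
      unfolding canonical_series_def by simp
  next
    case False
    then have b: "fps_X ^ n dvd b - fps_X ^ p" "fps_X ^ n dvd b' - fps_X ^ p"
      using c_iff can can' by (auto simp: canonical_series_def)
    then have "fps_X ^ n dvd b - b'"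
      using dvd_diff[OF b] by simp
    moreover have "fps_X ^ m dvd a' - a" "fps_X ^ n dvd c' - c" "fps_X ^ n dvd d' - d"
      using canonical_parameters_unique[OF nm(1,2) intertwines_swap[OF int] _ _ b(2,1) _ _ top[symmetric] x w]
        can can'
      unfolding canonical_series_def by simp_all
    ultimately show ?thesis by (simp add: dvd_diff_commute)
  qed
  then show ?thesis using nm by (simp add: T_ser_eq_iff)
qed

lemma similar_pairs_sym: "similar_pairs A B C D \<Longrightarrow> similar_pairs C D A B"
  unfolding similar_pairs_def using similar_mat_wit_sym by blast

lemma similar_pairs_trans: "similar_pairs A B C D \<Longrightarrow> similar_pairs C D E F \<Longrightarrow> similar_pairs A B E F"
  unfolding similar_pairs_def using similar_mat_wit_trans by blast

lemma similar_mat_wit_imp_commute: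
  assumes "similar_mat_wit C A X' X"
  shows "A * X = X * C"
proof -
  define N where "N = dim_row C"
  note X = similar_mat_witD[OF N_def assms]
  have "X * C = X * (X' * (A * X))"
    unfolding X(3) using X(5-7) by simp
  also have "\<dots> = (X * X') * (A * X)"
    using X(5-7) by (intro assoc_mult_mat[symmetric]) auto
  finally show ?thesis using X(2,5,7) by simp
qed

text \<open>
  A similarity between canonical forms commutes with \<open>J\<^sub>m \<oplus> J\<^sub>n\<close>, as this is the first matrix of both
  pairs. It is therefore itself a matrix \<open>T\<close>, and the question is one about power series.
\<close>
theorem canonical_form_unique:
  assumes "in_canonical_form A B" "in_canonical_form C D" and sim: "similar_pairs A B C D"
  shows "A = C" "B = D"
proof -
  obtain m n p a b c d where can: "canonical_series m n p a b c d"
    and A: "A = JJ m n" and B: "B = T_ser m n a b c d"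
    using assms(1) unfolding in_canonical_form_iff by blast
  obtain m' n' p' a' b' c' d' where can': "canonical_series m' n' p' a' b' c' d'"
    and C: "C = JJ m' n'" and D: "D = T_ser m' n' a' b' c' d'"
    using assms(2) unfolding in_canonical_form_iff by blast
  obtain X X' where wC: "similar_mat_wit C A X' X" and wD: "similar_mat_wit D B X' X"
    using sim unfolding similar_pairs_def by blast
  have nm: "0 < n" "n < m" "0 < n'" "n' < m'"
    using can can' by (auto simp: canonical_series_def)
  have eq: "m' = m" "n' = n"
    using similar_JJ_imp_eq[OF nm(3,4,1,2)] wC A C by blast+
  show "A = C" using A C eq by simp
  note X = similar_mat_witD2[OF T_ser_carrier wD[unfolded D eq]]
  have "JJ m n * X = X * JJ m n" "JJ m n * X' = X' * JJ m n"
    using similar_mat_wit_imp_commute[OF wC] similar_mat_wit_imp_commute[OF similar_mat_wit_sym[OF wC]]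
    unfolding A C eq by simp_all
  then obtain x y z w x' y' z' w' where XT: "X = T_ser m n x y z w" and X'T: "X' = T_ser m n x' y' z' w'"
    using commutes_JJ_imp_T_ser[OF less_imp_le[OF nm(2)]] X(6,7) by metis
  have "fps_nth x 0 \<noteq> 0" "fps_nth w 0 \<noteq> 0"
    using T_ser_mult_eq_one_imp[OF nm(1,2)] X(2) unfolding XT X'T by blast+
  moreover have "intertwines m n a b c d x y z w a' b' c' d'"
    using similar_mat_wit_imp_commute[OF wD]
    unfolding B D XT eq mult_T_ser_eq_iff_intertwines[OF nm(1,2)] .
  ultimately show "B = D"
    using canonical_series_unique[OF can can'[unfolded eq]] unfolding B D eq by blast
qed

lemma is_the_canonical_form_forI:
  assumes "in_canonical_form C D" "similar_pairs A B C D"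
  shows "is_the_canonical_form_for A B C D"
proof -
  have "\<forall>C' D'. in_canonical_form C' D' \<and> similar_pairs A B C' D' \<longrightarrow> C' = C \<and> D' = D"
  proof (intro allI impI, elim conjE)
    fix C' D' assume C': "in_canonical_form C' D'" and "similar_pairs A B C' D'"
    then have "similar_pairs C' D' C D"
      using similar_pairs_trans[OF similar_pairs_sym assms(2)] by blast
    from canonical_form_unique[OF C' assms(1) this]
    show "C' = C \<and> D' = D" by (rule conjI)
  qed
  with assms show ?thesis
    unfolding is_the_canonical_form_for_def by (intro conjI)
qed

section \<open>Reaching the canonical form\<close>

text \<open>
  For the type \<open>B\<^bsub>m,n,r\<^esub>\<close> the equation \<open>B X = X D\<close> with \<open>X = [1, y; 0, w]\<close> can be solved for \<open>D\<close> entry by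
  entry. The factor \<open>w\<close> absorbs the unit part of \<open>c\<close>. With \<open>e = t\<^sup>m\<^sup>-\<^sup>r y\<close> the diagonal becomes
  \<open>a - e\<close> and \<open>d + e\<close>, so \<open>y\<close> is chosen to move the top \<open>r\<close> coefficients of \<open>a\<close> away.
  The last conclusion, where the off-diagonal series have changed places, serves the type
  \<open>B'\<^bsub>m,n,r\<^esub>\<close>, which requires one more coefficient to vanish.
\<close>
lemma normalizing_series:
  fixes a b c d y w :: "'a::field fps"
  assumes nm: "p < n" "n < m" and a0: "fps_nth a 0 = 0"
    and b: "fps_X ^ p dvd b" and c: "c = fps_X ^ p * w" and ad: "fps_X ^ (p + 1) dvd a - d"
    and y: "\<And>i. i < n - p \<Longrightarrow> fps_nth y i = fps_nth a (m - (n - p) + i)"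
  obtains a' b' d' where
    "canonical_series m n p a' b' (fps_X ^ p) d'"
    "intertwines m n a b c d 1 y 0 w a' b' (fps_X ^ p) d'"
    "fps_nth b p = 0 \<Longrightarrow> canonical_series m n p a' (fps_X ^ p) b' d'"
proof
  let ?X = "fps_X :: 'a fps"
  define e where "e = ?X ^ (m - n) * (?X ^ p * y)"
  define b' where "b' = (a - (d + e)) * y + b * w"
  have e: "e = ?X ^ (m - n + p) * y"
    unfolding e_def by (simp add: power_add mult.assoc)
  have e_dvd: "?X ^ (p + 1) dvd e"
    unfolding e by (rule dvd_mult2, rule le_imp_power_dvd) (use nm in simp)
  have ade: "?X ^ (p + 1) dvd a - (d + e)"
    using dvd_diff[OF ad e_dvd] by (simp add: algebra_simps)
  have ade': "?X ^ (p + 1) dvd (a - e) - (d + e)"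
    using dvd_diff[OF ade e_dvd] by (simp add: algebra_simps)
  have a': "fps_nth (a - e) 0 = 0" "\<And>i. m - n + p \<le> i \<Longrightarrow> i < m \<Longrightarrow> fps_nth (a - e) i = 0"
    using nm a0 y[of "_ - (m - n + p)"] by (auto simp: e fps_X_power_mult_nth)
  have "?X ^ p dvd a - (d + e)"
    using ade by (rule X_power_dvd_le) simp
  then have b'_dvd: "?X ^ p dvd b'"
    unfolding b'_def using b by (intro dvd_add dvd_mult2)
  show can: "canonical_series m n p (a - e) b' (?X ^ p) (d + e)"
    unfolding canonical_series_def using nm a' ade' b'_dvd by auto
  show "intertwines m n a b c d 1 y 0 w (a - e) b' (?X ^ p) (d + e)"
    unfolding intertwines_def c by (simp add: b'_def e_def algebra_simps)
  assume "fps_nth b p = 0"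
  then have "fps_nth b' p = 0"
    using ade unfolding b'_def X_power_dvd_iff
    by (simp add: nth_mult_X_power_dvd b nth_mult_X_power_dvd[OF \<open>?X ^ p dvd a - (d + e)\<close>])
  then show "canonical_series m n p (a - e) (?X ^ p) b' (d + e)"
    using can unfolding canonical_series_def by auto
qed

lemma mat_inverse_eq_Some:
  assumes "X \<in> carrier_mat N N" "Y \<in> carrier_mat N N" "X * Y = 1\<^sub>m N" "Y * X = (1\<^sub>m N :: 'a::field mat)"
  obtains X' where "mat_inverse X = Some X'" "X' \<in> carrier_mat N N" "X * X' = 1\<^sub>m N" "X' * X = 1\<^sub>m N"
proof -
  have "X \<in> Units (ring_mat TYPE('a) N ())"
    using assms by (auto simp: Units_def ring_mat_def)
  then obtain X' where "mat_inverse X = Some X'"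
    using mat_inverse(1)[OF assms(1), of "()"] by (cases "mat_inverse X") auto
  with mat_inverse(2)[OF assms(1) this] that show thesis by blast
qed

lemma mat_inverse_triangular_T_ser:
  fixes w :: "'a::field fps"
  assumes "n \<le> m" "y = 0 \<or> z = 0" "fps_nth w 0 \<noteq> 0"
  obtains X' where "mat_inverse (T_ser m n 1 y z w) = Some X'"
    "X' \<in> carrier_mat (m + n) (m + n)"
    "T_ser m n 1 y z w * X' = 1\<^sub>m (m + n)" "X' * T_ser m n 1 y z w = 1\<^sub>m (m + n)"
proof -
  have w: "w * inverse w = 1" "inverse w * w = 1"
    using assms(3) by (simp_all add: inverse_mult_eq_1 inverse_mult_eq_1')
  let ?Y = "T_ser m n 1 (- y * inverse w) (- z * inverse w) (inverse w)"
  have "T_ser m n 1 y z w * ?Y = 1\<^sub>m (m + n)" "?Y * T_ser m n 1 y z w = 1\<^sub>m (m + n)"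
    using assms(2) w by (auto simp: T_ser_mult[OF assms(1)] one_mat_eq_T_ser mult.assoc mult.left_commute[of w])
  then show thesis
    by (rule mat_inverse_eq_Some[OF T_ser_carrier T_ser_carrier]) (rule that)
qed

lemma similar_pairs_conjugate:
  assumes XX': "X * X' = 1\<^sub>m N" "X' * X = 1\<^sub>m N" and X: "X \<in> carrier_mat N N" "X' \<in> carrier_mat N N"
    and A: "A \<in> carrier_mat N N" "C \<in> carrier_mat N N" "A * X = X * C"
    and B: "B \<in> carrier_mat N N" "D \<in> carrier_mat N N" "B * X = X * D"
  shows "similar_pairs A B C D" "X' * B * X = D"
proof -
  have "X' * E * X = F" if "E \<in> carrier_mat N N" "F \<in> carrier_mat N N" "E * X = X * F" for E F
  proof -
    have "X' * E * X = X' * (X * F)"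
      using that X by simp
    also have "\<dots> = (X' * X) * F"
      using that X by (intro assoc_mult_mat[symmetric]) auto
    finally show ?thesis using that XX' by simp
  qed
  note conj = this[OF A] this[OF B]
  show "X' * B * X = D" by (rule conj)
  show "similar_pairs A B C D"
    unfolding similar_pairs_def
    using conj assms by (intro exI[of _ X] exI[of _ X'] conjI similar_mat_witI[of _ _ N]) auto
qed

text \<open>
  Both directions of conjugation are needed: exchanging the off-diagonal parameters reverses products, so the
  normalizing matrix of the type \<open>B'\<^bsub>m,n,r\<^esub>\<close> acts by \<open>X B X\<^sup>-\<^sup>1\<close>.
\<close>
lemma canonical_form_by_conjugation:
  assumes "canonical_series m n p a' b' c' d'"
    and X: "X = T_ser m n x y z w" "X' \<in> carrier_mat (m + n) (m + n)"
    and XX': "X * X' = 1\<^sub>m (m + n)" "X' * X = 1\<^sub>m (m + n)"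
    and B: "B = T_ser m n a b c d"
  shows "intertwines m n a b c d x y z w a' b' c' d' \<Longrightarrow>
      is_the_canonical_form_for (JJ m n) B (JJ m n) (X' * B * X)"
    and "intertwines m n a' b' c' d' x y z w a b c d \<Longrightarrow>
      is_the_canonical_form_for (JJ m n) B (JJ m n) (X * B * X')"
proof -
  let ?D = "T_ser m n a' b' c' d'"
  have nm: "0 < n" "n < m" using assms(1) by (auto simp: canonical_series_def)
  have can: "in_canonical_form (JJ m n) ?D"
    using assms(1) unfolding in_canonical_form_iff by blast
  have XC: "X \<in> carrier_mat (m + n) (m + n)" unfolding X by simp
  have JX: "JJ m n * X = X * JJ m n"
    unfolding X using nm by (intro JJ_commutes_T_ser) simp
  have conj: "similar_pairs (JJ m n) B (JJ m n) ?D" "X' * B * X = ?D"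
    if "intertwines m n a b c d x y z w a' b' c' d'"
    using similar_pairs_conjugate[OF XX' XC X(2) JJ_carrier JJ_carrier JX, of B ?D] that
    by (auto simp: B X(1) mult_T_ser_eq_iff_intertwines nm)
  then show "is_the_canonical_form_for (JJ m n) B (JJ m n) (X' * B * X)"
    if "intertwines m n a b c d x y z w a' b' c' d'"
    using is_the_canonical_form_forI[OF can] that by metis
  assume int: "intertwines m n a' b' c' d' x y z w a b c d"
  have eq: "?D * X = X * B"
    using int unfolding B X(1) mult_T_ser_eq_iff_intertwines[OF nm] .
  have BC: "B \<in> carrier_mat (m + n) (m + n)" unfolding B by simp
  have sim: "similar_pairs (JJ m n) B (JJ m n) ?D"
    by (rule similar_pairs_sym, rule similar_pairs_conjugate(1)[OF XX' XC X(2) JJ_carrier JJ_carrier JX _ _ eq])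
      (simp_all add: BC)
  have "X * B * X' = ?D * X * X'" unfolding eq ..
  also have "\<dots> = ?D * (X * X')"
    using XC X(2) by (intro assoc_mult_mat[OF T_ser_carrier]) auto
  finally have "X * B * X' = ?D" unfolding XX' right_mult_one_mat[OF T_ser_carrier] .
  then show "is_the_canonical_form_for (JJ m n) B (JJ m n) (X * B * X')"
    using is_the_canonical_form_forI[OF can sim] by simp
qed

theorem theorem3p2:
  fixes A B :: "'a::field mat" and m n r :: nat and a b c d :: "nat \<Rightarrow> 'a"
  assumes "1 \<le> n" and "n < m"
    and "A = JJ m n"
    and "commuting_nilpotent_pair (m + n) A B"
    and "indecomposable_pair A B"
    and "canonical_rank m n B r"
    and "B = T_mat m n a b c d"
    and "a 0 = 0" and "d 0 = 0"
    and "\<forall>i < n - r. b i = 0 \<and> c i = 0"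
    and "\<forall>i. 1 \<le> i \<and> i \<le> n - r \<longrightarrow> d i = a i"
    and "(b (n - r), c (n - r)) \<noteq> (0, 0)"
  shows "(c (n - r) \<noteq> 0 \<longrightarrow>
            (let X = T_mat m n
                   (\<lambda>i. if i = 0 then 1 else 0)
                   (\<lambda>i. if i < r then a (m - r + i) else 0)
                   (\<lambda>i. 0)
                   (\<lambda>i. if i < r then c (n - r + i) else 0)
             in \<exists>X'. mat_inverse X = Some X' \<and>
                  is_the_canonical_form_for A B (JJ m n) (X' * B * X)))
       \<and> (c (n - r) = 0 \<and> b (n - r) \<noteq> 0 \<longrightarrow>
            (let X = T_mat m n
                   (\<lambda>i. if i = 0 then 1 else 0)
                   (\<lambda>i. 0)
                   (\<lambda>i. if i < r then a (m - r + i) else 0)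
                   (\<lambda>i. if i < r then b (n - r + i) else 0)
             in \<exists>X'. mat_inverse X = Some X' \<and>
                  is_the_canonical_form_for A B (JJ m n) (X * B * X')))"
proof -
  have r: "1 \<le> r" "r \<le> n"
    using assms(6) by (auto simp: canonical_rank_def)
  define p where "p = n - r"
  have p: "p < n" "n < m" "n - p = r" "n - r = p"
    using r assms(2) by (auto simp: p_def)
  define fa fb fc fd where "fa = Abs_fps a" "fb = Abs_fps b" "fc = Abs_fps c" "fd = Abs_fps d"
  note fdefs = this
  define u where "u = Abs_fps (\<lambda>i. if i < r then a (m - r + i) else 0)"
  define v where "v = (\<lambda>f :: nat \<Rightarrow> 'a. Abs_fps (\<lambda>i. if i < r then f (n - r + i) else 0))"
  have one: "Abs_fps (\<lambda>i. if i = 0 then 1 else 0) = (1 :: 'a fps)"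
    and zero: "Abs_fps (\<lambda>i. 0) = (0 :: 'a fps)"
    by (auto simp: fps_eq_iff)
  have a0: "fps_nth fa 0 = 0" and fb: "fps_X ^ p dvd fb" and fc: "fps_X ^ p dvd fc"
    and ad: "fps_X ^ (p + 1) dvd fa - fd"
    using assms(8-11) unfolding X_power_dvd_iff fdefs p(4)
    by (auto simp: less_Suc_eq_le) (metis One_nat_def Suc_leI gr0I)
  have u: "\<And>i. i < n - p \<Longrightarrow> fps_nth u i = fps_nth fa (m - (n - p) + i)"
    by (simp add: u_def fdefs p)
  have v: "fps_X ^ n dvd Abs_fps f - fps_X ^ p * v f" if "\<forall>i<p. f i = 0" for f
    unfolding X_power_dvd_iff using that r by (auto simp: v_def fps_X_power_mult_nth p_def)
  have v0: "fps_nth (v f) 0 = f p" for f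
    using r by (simp add: v_def p)
  show ?thesis
  proof (intro conjI impI; (elim conjE)?)
    assume c: "c (n - r) \<noteq> 0"
    \<comment> \<open>Only the coefficients of \<open>c\<close> below degree \<open>n\<close> enter \<open>B\<close>, and there \<open>c\<close> equals \<open>t\<^sup>p w\<close>.\<close>
    have B: "B = T_ser m n fa fb (fps_X ^ p * v c) fd"
      unfolding assms(7) T_mat_eq_T_ser fdefs[symmetric]
      using v[of c] assms(10) p by (simp add: T_ser_eq_iff fdefs)
    obtain X' where X': "mat_inverse (T_ser m n 1 u 0 (v c)) = Some X'"
      "X' \<in> carrier_mat (m + n) (m + n)"
      "T_ser m n 1 u 0 (v c) * X' = 1\<^sub>m (m + n)" "X' * T_ser m n 1 u 0 (v c) = 1\<^sub>m (m + n)"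
      using mat_inverse_triangular_T_ser[of n m u 0 "v c"] v0 c p by auto
    obtain a' b' d' where "canonical_series m n p a' b' (fps_X ^ p) d'"
      "intertwines m n fa fb (fps_X ^ p * v c) fd 1 u 0 (v c) a' b' (fps_X ^ p) d'"
      using normalizing_series[OF p(1,2) a0 fb refl ad u] by metis
    then have "is_the_canonical_form_for A B (JJ m n) (X' * B * T_ser m n 1 u 0 (v c))"
      unfolding assms(3) using canonical_form_by_conjugation(1)[OF _ refl X'(2-4) B] by blast
    then show "let X = T_mat m n
                   (\<lambda>i. if i = 0 then 1 else 0)
                   (\<lambda>i. if i < r then a (m - r + i) else 0)
                   (\<lambda>i. 0)
                   (\<lambda>i. if i < r then c (n - r + i) else 0)
             in \<exists>X'. mat_inverse X = Some X' \<and>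
                  is_the_canonical_form_for A B (JJ m n) (X' * B * X)"
      unfolding T_mat_eq_T_ser one zero Let_def u_def[symmetric] v_def[THEN fun_cong, symmetric]
      using X'(1) by blast
  next
    assume c: "c (n - r) = 0" and b: "b (n - r) \<noteq> 0"
    have B: "B = T_ser m n fa (fps_X ^ p * v b) fc fd"
      unfolding assms(7) T_mat_eq_T_ser fdefs[symmetric]
      using v[of b] assms(10) p by (simp add: T_ser_eq_iff fdefs)
    obtain X' where X': "mat_inverse (T_ser m n 1 0 u (v b)) = Some X'"
      "X' \<in> carrier_mat (m + n) (m + n)"
      "T_ser m n 1 0 u (v b) * X' = 1\<^sub>m (m + n)" "X' * T_ser m n 1 0 u (v b) = 1\<^sub>m (m + n)"
      using mat_inverse_triangular_T_ser[of n m 0 u "v b"] v0 b p by auto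
    have "fps_nth fc p = 0" using c p by (simp add: fdefs)
    then obtain a' c' d' where "canonical_series m n p a' (fps_X ^ p) c' d'"
      "intertwines m n fa fc (fps_X ^ p * v b) fd 1 u 0 (v b) a' c' (fps_X ^ p) d'"
      using normalizing_series[OF p(1,2) a0 fc refl ad u] by metis
    \<comment> \<open>The normalization was carried out with \<open>b\<close> and \<open>c\<close> exchanged; undoing the exchange turns
      \<open>B X = X D\<close> into \<open>D X = X B\<close>.\<close>
    then have "is_the_canonical_form_for A B (JJ m n) (T_ser m n 1 0 u (v b) * B * X')"
      unfolding assms(3)
      using canonical_form_by_conjugation(2)[OF _ refl X'(2-4) B] intertwines_swap by blast
    then show "let X = T_mat m n
                   (\<lambda>i. if i = 0 then 1 else 0)
                   (\<lambda>i. 0)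
                   (\<lambda>i. if i < r then a (m - r + i) else 0)
                   (\<lambda>i. if i < r then b (n - r + i) else 0)
             in \<exists>X'. mat_inverse X = Some X' \<and>
                  is_the_canonical_form_for A B (JJ m n) (X * B * X')"
      unfolding T_mat_eq_T_ser one zero Let_def u_def[symmetric] v_def[THEN fun_cong, symmetric]
      using X'(1) by blast
  qed
qed

end
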